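(* Let $\Gamma$ be a distance-regular graph with vertex set $X$ and diameter $D\ge1$, formally self-dual with respect to the ordering $\{E_i\}_{i=0}^D$ of its primitive idempotents. Let $f,\{\tau_i\}_{i=0}^D$ be nonzero complex scalars with $\tau_0=1$. Define $W=f\sum_{i=0}^D\tau_iE_i$, and for $x\in X$ define $W^*(x)=f\sum_{i=0}^D\tau_iE_i^*(x)$. Assume that for all $x\in X$ and all irreducible $T(x)$-modules $U$: (i) $U$ is thin; (ii) $U$ has the same endpoint and dual endpoint; (iii) the pair $A_1,A_1^*(x)$ acts on $U$ as a spin Leonard pair, and $W,W^*(x)$ acts on $U$ as a balanced Boltzmann pair for this spin Leonard pair; (iv) $f^{-2}=|X|^{-3/2}\sum_{i=0}^Dk_i\tau_i$. Then the matrix $W$ (which under these assumptions is a spin model) is afforded by $\Gamma$; that is, $W\in M\subseteq N(W)$.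
   Context: Distance-regular graphs. $X$ is a finite nonempty set; $\mathrm{Mat}_X(\mathbb C)$ is the algebra of complex matrices with rows and columns indexed by $X$; $I$ is the identity and $J$ the all-ones matrix; $V=\mathbb C^X$ is the space of column vectors indexed by $X$, on which $\mathrm{Mat}_X(\mathbb C)$ acts by left multiplication. $\Gamma$ is an undirected connected graph without loops or multiple edges, vertex set $X$, path-length distance $\partial$, diameter $D=\max\partial$. It is distance-regular if for all $0\le h,i,j\le D$ and all $x,y$ with $\partial(x,y)=h$ the number $p^h_{ij}=|\{z:\partial(x,z)=i,\ \partial(y,z)=j\}|$ depends only on $h,i,j$. Put $k_i=p^0_{ii}$. The distance-matrix $A_i$ has $(x,y)$-entry $1$ if $\partial(x,y)=i$ and $0$ otherwise. The Bose-Mesner algebra $M=\mathrm{Span}\{A_i\}_{i=0}^D$ is a commutative subalgebra and has a basis $\{E_i\}_{i=0}^D$ with $E_0=|X|^{-1}J$, $E_iE_j=\delta_{ij}E_i$, $\sum_iE_i=I$ (the primitive idempotents; the ordering of $E_1,\dots,E_D$ is part of the data). Define matrices $P,Q$ by $A_j=\sum_iP_{ij}E_i$, $E_j=|X|^{-1}\sum_iQ_{ij}A_i$. $\Gamma$ is formally self-dual with respect to $\{E_i\}_{i=0}^D$ if $P=Q$. For $x\in X$: $E_i^*(x)$ is the diagonal matrix with $(y,y)$-entry $1$ if $\partial(x,y)=i$ and $0$ otherwise; $A_i^*(x)$ is the diagonal matrix with $(y,y)$-entry $|X|E_i(x,y)$; $T(x)$ is the subalgebra of $\mathrm{Mat}_X(\mathbb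 C)$ generated by $M$ and all $E_i^*(x)$. A $T(x)$-module is a subspace of $V$ invariant under $T(x)$; it is irreducible if it is nonzero and has no submodules except $0$ and itself. For an irreducible $T(x)$-module $U$: the endpoint is $\min\{i:E_i^*(x)U\ne0\}$; the dual endpoint is $\min\{i:E_iU\neq0\}$; $U$ is thin if $\dim E_i^*(x)U\le1$ for all $i$. Leonard pairs. A Leonard pair on a nonzero finite-dimensional vector space $U$ is an ordered pair of linear maps $A,A^*:U\to U$ such that there is a basis of $U$ for which $A$ is irreducible tridiagonal and $A^*$ diagonal, and a basis for which $A^*$ is irreducible tridiagonal and $A$ diagonal (a tridiagonal matrix is irreducible if all its subdiagonal and superdiagonal entries are nonzero). Let $\langle A\rangle$ be the subalgebra of $\mathrm{End}(U)$ generated by $A$. A Boltzmann pair for the Leonard pair $A,A^*$ is an ordered pair $W,W^*$ with $W\in\langle A\rangle$ and $W^*\in\langle A^*\rangle$ invertible such that $WA^*W^{-1}=(W^* )^{-1}AW^*$; it is balanced if $WW^*W=W^*WW^*$. A Leonard pair is a spin Leonard pair if it has a Boltzmann pair. Spin models. $W\in\mathrm{Mat}_X(\mathbb C)$ is type II if it is symmetric with all entries nonzero and $\sum_{y\in X}W(a,y)/W(b,y)=|X|\delta_{a,b}$ for all $a,b\in X$. It is a spin model if it is type II and $\sum_{y\in X}\frac{W(a,y)W(b,y)}{W(c,y)}=|X|^{1/2}\frac{W(a,b)}{W(a,c)W(b,c)}$ for all $a,b,c\in X$ (positive square root). For $W$ type II, let $\mathbf u_{b,c}\in V$ have $y$-entry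 $W(b,y)/W(c,y)$, and let $N(W)$ be the set of symmetric $B\in\mathrm{Mat}_X(\mathbb C)$ with $B\mathbf u_{b,c}\in\mathbb C\mathbf u_{b,c}$ for all $b,c\in X$. $\Gamma$ affords the spin model $W$ if $W\in M\subseteq N(W)$. *)

theory Defs
  imports "HOL-Analysis.Analysis"
begin

text \<open>
  The vertex set \<open>X\<close> is the universe of a finite type \<open>'n\<close>, so that
  \<open>complex^'n\<close> is the standard module \<open>V\<close> and \<open>complex^'n^'n\<close> is the full matrix algebra.
\<close>

section \<open>Complex matrices as an algebra\<close>

text \<open>
  The library operation \<open>*s\<close> on \<open>complex^'n^'n\<close> would take scalars from \<open>complex^'n\<close>;
  hence a separate operation for complex scalars.
\<close>

definition cscale :: "complex \<Rightarrow> complex^'n^'n \<Rightarrow> complex^'n^'n" (infixr "*\<^sub>m" 75)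
  where "c *\<^sub>m B = (\<chi> i j. c * B $ i $ j)"

global_interpretation cmat: vector_space cscale
  by unfold_locales (simp_all add: cscale_def vec_eq_iff algebra_simps)

definition subalgebra :: "(complex^'n^'n) set \<Rightarrow> bool"
  where "subalgebra S \<longleftrightarrow>
    cmat.subspace S \<and> mat 1 \<in> S \<and> (\<forall>B\<in>S. \<forall>C\<in>S. B ** C \<in> S)"

section \<open>Distance-regular graphs\<close>

definition gdist :: "('n \<Rightarrow> 'n \<Rightarrow> bool) \<Rightarrow> 'n \<Rightarrow> 'n \<Rightarrow> nat"
  where "gdist adj x y = (LEAST n. (adj ^^ n) x y)"

definition gdiameter :: "('n::finite \<Rightarrow> 'n \<Rightarrow> bool) \<Rightarrow> nat"
  where "gdiameter adj = Max {gdist adj x y | x y. True}"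

definition simple_connected_graph :: "('n \<Rightarrow> 'n \<Rightarrow> bool) \<Rightarrow> bool"
  where "simple_connected_graph adj \<longleftrightarrow>
    (\<forall>x y. adj x y \<longrightarrow> adj y x) \<and> (\<forall>x. \<not> adj x x) \<and> (\<forall>x y. adj\<^sup>*\<^sup>* x y)"

definition distance_regular :: "('n::finite \<Rightarrow> 'n \<Rightarrow> bool) \<Rightarrow> bool"
  where "distance_regular adj \<longleftrightarrow> simple_connected_graph adj \<and>
    (\<forall>h\<le>gdiameter adj. \<forall>i\<le>gdiameter adj. \<forall>j\<le>gdiameter adj.
      \<forall>x y x' y'. gdist adj x y = h \<longrightarrow> gdist adj x' y' = h \<longrightarrow>
        card {z. gdist adj x z = i \<and> gdist adj y z = j} =
        card {z. gdist adj x' z = i \<and> gdist adj y' z = j})"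

text \<open>
  Well-defined for a distance-regular graph and \<open>h, i, j\<close> at most the diameter, since
  then some pair of vertices is at distance \<open>h\<close>.
\<close>

definition intersection_number :: "('n::finite \<Rightarrow> 'n \<Rightarrow> bool) \<Rightarrow> nat \<Rightarrow> nat \<Rightarrow> nat \<Rightarrow> nat"
  where "intersection_number adj h i j =
    (THE p. \<forall>x y. gdist adj x y = h \<longrightarrow>
      card {z. gdist adj x z = i \<and> gdist adj y z = j} = p)"

definition valency :: "('n::finite \<Rightarrow> 'n \<Rightarrow> bool) \<Rightarrow> nat \<Rightarrow> nat"
  where "valency adj i = intersection_number adj 0 i i"

definition dist_matrix :: "('n::finite \<Rightarrow> 'n \<Rightarrow> bool) \<Rightarrow> nat \<Rightarrow> complex^'n^'n"
  where "dist_matrix adj i = (\<chi> x y. if gdist adj x y = i then 1 else 0)"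

definition bose_mesner :: "('n::finite \<Rightarrow> 'n \<Rightarrow> bool) \<Rightarrow> (complex^'n^'n) set"
  where "bose_mesner adj = cmat.span (dist_matrix adj ` {..gdiameter adj})"

text \<open>Only the values \<open>E i\<close> with \<open>i\<close> at most the diameter are meaningful.\<close>

definition primitive_idempotents ::
    "('n::finite \<Rightarrow> 'n \<Rightarrow> bool) \<Rightarrow> (nat \<Rightarrow> complex^'n^'n) \<Rightarrow> bool"
  where "primitive_idempotents adj E \<longleftrightarrow>
    inj_on E {..gdiameter adj} \<and>
    cmat.independent (E ` {..gdiameter adj}) \<and>
    cmat.span (E ` {..gdiameter adj}) = bose_mesner adj \<and>
    E 0 = (1 / of_nat CARD('n)) *\<^sub>m (\<chi> x y. 1) \<and>
    (\<forall>i\<le>gdiameter adj. \<forall>j\<le>gdiameter adj. E i ** E j = (if i = j then E i else 0)) \<and>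
    (\<Sum>i\<le>gdiameter adj. E i) = mat 1"

definition first_eigenmatrix ::
    "('n::finite \<Rightarrow> 'n \<Rightarrow> bool) \<Rightarrow> (nat \<Rightarrow> complex^'n^'n) \<Rightarrow> (nat \<Rightarrow> nat \<Rightarrow> complex) \<Rightarrow> bool"
  where "first_eigenmatrix adj E P \<longleftrightarrow>
    (\<forall>j\<le>gdiameter adj. dist_matrix adj j = (\<Sum>i\<le>gdiameter adj. P i j *\<^sub>m E i))"

definition second_eigenmatrix ::
    "('n::finite \<Rightarrow> 'n \<Rightarrow> bool) \<Rightarrow> (nat \<Rightarrow> complex^'n^'n) \<Rightarrow> (nat \<Rightarrow> nat \<Rightarrow> complex) \<Rightarrow> bool"
  where "second_eigenmatrix adj E Q \<longleftrightarrow>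
    (\<forall>j\<le>gdiameter adj.
      E j = (1 / of_nat CARD('n)) *\<^sub>m (\<Sum>i\<le>gdiameter adj. Q i j *\<^sub>m dist_matrix adj i))"

text \<open>
  If \<open>E\<close> lists the primitive idempotents, then \<open>P\<close> and \<open>Q\<close> exist and are unique on indices
  up to the diameter, because both families are bases of the Bose-Mesner algebra.
\<close>

definition formally_self_dual ::
    "('n::finite \<Rightarrow> 'n \<Rightarrow> bool) \<Rightarrow> (nat \<Rightarrow> complex^'n^'n) \<Rightarrow> bool"
  where "formally_self_dual adj E \<longleftrightarrow>
    (\<exists>P Q. first_eigenmatrix adj E P \<and> second_eigenmatrix adj E Q \<and>
      (\<forall>i\<le>gdiameter adj. \<forall>j\<le>gdiameter adj. P i j = Q i j))"

section \<open>Terwilliger algebra and its modules\<close>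

definition dual_idempotent :: "('n::finite \<Rightarrow> 'n \<Rightarrow> bool) \<Rightarrow> 'n \<Rightarrow> nat \<Rightarrow> complex^'n^'n"
  where "dual_idempotent adj x i = (\<chi> y z. if y = z \<and> gdist adj x y = i then 1 else 0)"

definition dual_dist_matrix :: "(nat \<Rightarrow> complex^'n^'n) \<Rightarrow> 'n::finite \<Rightarrow> nat \<Rightarrow> complex^'n^'n"
  where "dual_dist_matrix E x i =
    (\<chi> y z. if y = z then of_nat CARD('n) * E i $ x $ y else 0)"

definition terwilliger_algebra :: "('n::finite \<Rightarrow> 'n \<Rightarrow> bool) \<Rightarrow> 'n \<Rightarrow> (complex^'n^'n) set"
  where "terwilliger_algebra adj x =
    subalgebra hull (bose_mesner adj \<union> dual_idempotent adj x ` {..gdiameter adj})"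

definition T_module :: "('n::finite \<Rightarrow> 'n \<Rightarrow> bool) \<Rightarrow> 'n \<Rightarrow> (complex^'n) set \<Rightarrow> bool"
  where "T_module adj x U \<longleftrightarrow>
    vec.subspace U \<and> (\<forall>B\<in>terwilliger_algebra adj x. \<forall>u\<in>U. B *v u \<in> U)"

definition irreducible_T_module :: "('n::finite \<Rightarrow> 'n \<Rightarrow> bool) \<Rightarrow> 'n \<Rightarrow> (complex^'n) set \<Rightarrow> bool"
  where "irreducible_T_module adj x U \<longleftrightarrow>
    T_module adj x U \<and> U \<noteq> {0} \<and>
    (\<forall>U'. T_module adj x U' \<and> U' \<subseteq> U \<longrightarrow> U' = {0} \<or> U' = U)"

definition endpoint :: "('n::finite \<Rightarrow> 'n \<Rightarrow> bool) \<Rightarrow> 'n \<Rightarrow> (complex^'n) set \<Rightarrow> nat"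
  where "endpoint adj x U =
    (LEAST i. i \<le> gdiameter adj \<and> (*v) (dual_idempotent adj x i) ` U \<noteq> {0})"

definition dual_endpoint ::
    "('n::finite \<Rightarrow> 'n \<Rightarrow> bool) \<Rightarrow> (nat \<Rightarrow> complex^'n^'n) \<Rightarrow> (complex^'n) set \<Rightarrow> nat"
  where "dual_endpoint adj E U = (LEAST i. i \<le> gdiameter adj \<and> (*v) (E i) ` U \<noteq> {0})"

definition thin :: "('n::finite \<Rightarrow> 'n \<Rightarrow> bool) \<Rightarrow> 'n \<Rightarrow> (complex^'n) set \<Rightarrow> bool"
  where "thin adj x U \<longleftrightarrow>
    (\<forall>i\<le>gdiameter adj. vec.dim ((*v) (dual_idempotent adj x i) ` U) \<le> 1)"

section \<open>Leonard pairs on a subspace\<close>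

text \<open>
  Linear maps \<open>U \<rightarrow> U\<close> are represented by functions that are \<open>undefined\<close> outside \<open>U\<close>, so that
  equality of functions is equality in \<open>End(U)\<close>, and \<open>compose U\<close> is multiplication.
\<close>

definition End_on :: "(complex^'n) set \<Rightarrow> (complex^'n \<Rightarrow> complex^'n) set"
  where "End_on U = {g \<in> U \<rightarrow>\<^sub>E U.
    (\<forall>u\<in>U. \<forall>v\<in>U. g (u + v) = g u + g v) \<and> (\<forall>c. \<forall>u\<in>U. g (c *s u) = c *s g u)}"

definition act :: "(complex^'n) set \<Rightarrow> complex^'n^'n \<Rightarrow> complex^'n \<Rightarrow> complex^'n::finite"
  where "act U B = restrict ((*v) B) U"

inductive_set generated_subalgebra ::
    "(complex^'n) set \<Rightarrow> (complex^'n \<Rightarrow> complex^'n) \<Rightarrow> (complex^'n \<Rightarrow> complex^'n) set"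
  for U :: "(complex^'n) set" and A :: "complex^'n \<Rightarrow> complex^'n"
  where
    one: "(\<lambda>u\<in>U. u) \<in> generated_subalgebra U A"
  | gen: "A \<in> generated_subalgebra U A"
  | add: "g \<in> generated_subalgebra U A \<Longrightarrow> h \<in> generated_subalgebra U A \<Longrightarrow>
      (\<lambda>u\<in>U. g u + h u) \<in> generated_subalgebra U A"
  | scale: "g \<in> generated_subalgebra U A \<Longrightarrow> (\<lambda>u\<in>U. c *s g u) \<in> generated_subalgebra U A"
  | mult: "g \<in> generated_subalgebra U A \<Longrightarrow> h \<in> generated_subalgebra U A \<Longrightarrow>
      compose U g h \<in> generated_subalgebra U A"

text \<open>\<open>v 0, \<dots>, v d\<close> is a basis of \<open>U\<close>.\<close>

definition indexed_basis :: "(complex^'n) set \<Rightarrow> nat \<Rightarrow> (nat \<Rightarrow> complex^'n) \<Rightarrow> bool"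
  where "indexed_basis U d v \<longleftrightarrow>
    inj_on v {..d} \<and> vec.independent (v ` {..d}) \<and> vec.span (v ` {..d}) = U"

text \<open>Column convention: column \<open>j\<close> of \<open>B\<close> holds the coordinates of the image of \<open>v j\<close>.\<close>

definition represents ::
    "nat \<Rightarrow> (nat \<Rightarrow> complex^'n) \<Rightarrow> (complex^'n \<Rightarrow> complex^'n) \<Rightarrow> (nat \<Rightarrow> nat \<Rightarrow> complex) \<Rightarrow> bool"
  where "represents d v A B \<longleftrightarrow> (\<forall>j\<le>d. A (v j) = (\<Sum>i\<le>d. B i j *s v i))"

definition diagonal :: "nat \<Rightarrow> (nat \<Rightarrow> nat \<Rightarrow> complex) \<Rightarrow> bool"
  where "diagonal d B \<longleftrightarrow> (\<forall>i\<le>d. \<forall>j\<le>d. i \<noteq> j \<longrightarrow> B i j = 0)"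

definition irreducible_tridiagonal :: "nat \<Rightarrow> (nat \<Rightarrow> nat \<Rightarrow> complex) \<Rightarrow> bool"
  where "irreducible_tridiagonal d B \<longleftrightarrow>
    (\<forall>i\<le>d. \<forall>j\<le>d. i + 1 < j \<or> j + 1 < i \<longrightarrow> B i j = 0) \<and>
    (\<forall>i<d. B i (i + 1) \<noteq> 0 \<and> B (i + 1) i \<noteq> 0)"

definition tridiagonal_diagonal_basis ::
    "(complex^'n) set \<Rightarrow> (complex^'n \<Rightarrow> complex^'n) \<Rightarrow> (complex^'n \<Rightarrow> complex^'n) \<Rightarrow> bool"
  where "tridiagonal_diagonal_basis U A A' \<longleftrightarrow>
    (\<exists>d v B B'. indexed_basis U d v \<and>
      represents d v A B \<and> irreducible_tridiagonal d B \<and>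
      represents d v A' B' \<and> diagonal d B')"

definition leonard_pair ::
    "(complex^'n) set \<Rightarrow> (complex^'n \<Rightarrow> complex^'n) \<Rightarrow> (complex^'n \<Rightarrow> complex^'n) \<Rightarrow> bool"
  where "leonard_pair U A Astar \<longleftrightarrow>
    vec.subspace U \<and> U \<noteq> {0} \<and> A \<in> End_on U \<and> Astar \<in> End_on U \<and>
    tridiagonal_diagonal_basis U A Astar \<and> tridiagonal_diagonal_basis U Astar A"

definition inverse_on :: "(complex^'n) set \<Rightarrow> (complex^'n \<Rightarrow> complex^'n) \<Rightarrow> complex^'n \<Rightarrow> complex^'n"
  where "inverse_on U g = restrict (inv_into U g) U"

definition boltzmann_pair ::
    "(complex^'n) set \<Rightarrow> (complex^'n \<Rightarrow> complex^'n) \<Rightarrow> (complex^'n \<Rightarrow> complex^'n) \<Rightarrow>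
     (complex^'n \<Rightarrow> complex^'n) \<Rightarrow> (complex^'n \<Rightarrow> complex^'n) \<Rightarrow> bool"
  where "boltzmann_pair U A Astar W Wstar \<longleftrightarrow>
    W \<in> generated_subalgebra U A \<and> Wstar \<in> generated_subalgebra U Astar \<and>
    bij_betw W U U \<and> bij_betw Wstar U U \<and>
    compose U W (compose U Astar (inverse_on U W)) =
      compose U (inverse_on U Wstar) (compose U A Wstar)"

definition balanced ::
    "(complex^'n) set \<Rightarrow> (complex^'n \<Rightarrow> complex^'n) \<Rightarrow> (complex^'n \<Rightarrow> complex^'n) \<Rightarrow> bool"
  where "balanced U W Wstar \<longleftrightarrow>
    compose U W (compose U Wstar W) = compose U Wstar (compose U W Wstar)"

definition spin_leonard_pair ::
    "(complex^'n) set \<Rightarrow> (complex^'n \<Rightarrow> complex^'n) \<Rightarrow> (complex^'n \<Rightarrow> complex^'n) \<Rightarrow> bool"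
  where "spin_leonard_pair U A Astar \<longleftrightarrow>
    leonard_pair U A Astar \<and> (\<exists>W Wstar. boltzmann_pair U A Astar W Wstar)"

section \<open>Spin models\<close>

definition type_II :: "complex^'n^'n::finite \<Rightarrow> bool"
  where "type_II W \<longleftrightarrow>
    transpose W = W \<and> (\<forall>a b. W $ a $ b \<noteq> 0) \<and>
    (\<forall>a b. (\<Sum>y\<in>UNIV. W $ a $ y / W $ b $ y) = (if a = b then of_nat CARD('n) else 0))"

definition spin_model :: "complex^'n^'n::finite \<Rightarrow> bool"
  where "spin_model W \<longleftrightarrow> type_II W \<and>
    (\<forall>a b c. (\<Sum>y\<in>UNIV. W $ a $ y * W $ b $ y / W $ c $ y) =
      complex_of_real (sqrt (real CARD('n))) * (W $ a $ b / (W $ a $ c * W $ b $ c)))"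

definition nomura_vector :: "complex^'n^'n \<Rightarrow> 'n \<Rightarrow> 'n \<Rightarrow> complex^'n"
  where "nomura_vector W b c = (\<chi> y. W $ b $ y / W $ c $ y)"

definition nomura_algebra :: "complex^'n^'n::finite \<Rightarrow> (complex^'n^'n) set"
  where "nomura_algebra W =
    {B. transpose B = B \<and>
      (\<forall>b c. \<exists>r. B *v nomura_vector W b c = r *s nomura_vector W b c)}"

definition affords :: "('n::finite \<Rightarrow> 'n \<Rightarrow> bool) \<Rightarrow> complex^'n^'n \<Rightarrow> bool"
  where "affords adj W \<longleftrightarrow>
    spin_model W \<and> W \<in> bose_mesner adj \<and> bose_mesner adj \<subseteq> nomura_algebra W"

end

theory Submission
  imports Defs
begin

text \<open>
  Write \<open>n = |X|\<close>, \<open>A = A\<^sub>1\<close>, \<open>A\<^sup>* = A\<^sub>1\<^sup>*(x)\<close> and \<open>W\<^sup>* = W\<^sup>*(x)\<close>. The algebra \<open>T(x)\<close> is generated by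
  real symmetric matrices, so the orthogonal complement of a \<open>T(x)\<close>-module is a
  \<open>T(x)\<close>-module, and \<open>V\<close> is spanned by irreducible modules
  (\<open>span_irreducible_T_modules\<close>). An equation of matrices may therefore be checked on
  irreducible modules, and the hypotheses on them become two matrix identities:
  the balance condition \<open>W W\<^sup>* W = W\<^sup>* W W\<^sup>*\<close> and the Boltzmann condition \<open>A W\<^sup>* W = W\<^sup>* W A\<^sup>*\<close>.
  All four matrices are symmetric, so transposing the latter gives \<open>W W\<^sup>* A = A\<^sup>* W W\<^sup>*\<close>.

  Let \<open>S = f \<Sum> \<tau>\<^sub>i A\<^sub>i\<close>; its row at \<open>x\<close> is the diagonal of \<open>W\<^sup>*(x)\<close>, so that column \<open>x\<close> of \<open>W S\<close> is
  \<open>W W\<^sup>* 1\<close> with \<open>1\<close> the all-ones vector. As \<open>A 1 = \<theta>\<^sub>0 1\<close>, the transposed identity makes this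
  column an eigenvector of the diagonal matrix \<open>A\<^sup>*\<close> for \<open>\<theta>\<^sub>0\<close>. By formal self-duality the
  \<open>(y,y)\<close>-entry of \<open>A\<^sup>*\<close> is the eigenvalue \<open>\<theta>\<^sub>i\<close> of \<open>A\<close>, with \<open>i\<close> the distance from \<open>x\<close> to \<open>y\<close>, and
  \<open>\<theta>\<^sub>i \<noteq> \<theta>\<^sub>0\<close> for \<open>i > 0\<close> (\<open>eigenvalue_0_simple\<close>). Hence \<open>W S\<close> is diagonal, and the normalisation of \<open>f\<close>
  says exactly that \<open>W S = n\<^bsup>3/2\<^esup> I\<close>. Thus \<open>S\<close> is a multiple of \<open>\<Sum> \<tau>\<^sub>i\<^bsup>-1\<^esup> E\<^sub>i\<close>, and
  self-duality (\<open>self_dual_coefficients\<close>) turns this into \<open>W(x,y) S(x,y) = n\<^bsup>1/2\<^esup>\<close>: the diagonal of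
  \<open>W\<^sup>*(x)\<close> is \<open>n\<^bsup>1/2\<^esup>\<close> times the entrywise reciprocal of row \<open>x\<close> of \<open>W\<close>.

  Everything now follows by reading entries. The equation \<open>W S = n\<^bsup>3/2\<^esup> I\<close> is the type II
  condition, and the balance condition is the star-triangle relation
  (\<open>spin_model_of_braid_relation\<close>). Column \<open>b\<close> of \<open>W\<^sup>*(c) W\<close> is a multiple of the vector with
  entries \<open>W(b,y)/W(c,y)\<close>, and the Boltzmann condition says that it is an eigenvector of \<open>A\<close>, hence
  of all of the Bose-Mesner algebra, which \<open>A\<close> generates.
\<close>

section \<open>Complex scalars and matrix products\<close>

lemma cscale_nth [simp]: "(c *\<^sub>m B) $ i $ j = c * B $ i $ j"
  by (simp add: cscale_def)

lemma cscale_mult_left: "(c *\<^sub>m B) ** C = c *\<^sub>m (B ** C)"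
  by (simp add: vec_eq_iff matrix_matrix_mult_def sum_distrib_left mult.assoc)

lemma cscale_mult_right: "B ** (c *\<^sub>m C) = c *\<^sub>m (B ** C)"
  by (simp add: vec_eq_iff matrix_matrix_mult_def sum_distrib_left algebra_simps)

lemma cscale_mult_vec: "(c *\<^sub>m B) *v v = c *s (B *v v)"
  by (simp add: vec_eq_iff matrix_vector_mult_def sum_distrib_left mult.assoc)

lemma sum_matrix_mult: "sum (F :: _ \<Rightarrow> complex^'n^'m) S ** B = (\<Sum>i\<in>S. F i ** B)"
proof -
  have add: "(C + F') ** B = C ** B + F' ** B" for C F' :: "complex^'n^'m"
    by (simp add: vec_eq_iff matrix_matrix_mult_def distrib_right sum.distrib)
  show ?thesis
    by (induction S rule: infinite_finite_induct) (auto simp: add)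
qed

lemma sum_matrix_vector_mult: "sum F S *v (v :: complex^'n) = (\<Sum>i\<in>S. F i *v v)"
  by (induction S rule: infinite_finite_induct) (auto simp: matrix_vector_mult_add_rdistrib)

lemma mult_diagonal_matrix:
  "(B ** (\<chi> y z. if y = z then d y else 0)) $ a $ b = B $ a $ b * (d b :: complex)"
  by (simp add: matrix_matrix_mult_def mult_delta_right)

lemma diagonal_matrix_mult:
  "((\<chi> y z. if y = z then d y else 0) ** B) $ a $ b = (d a :: complex) * B $ a $ b"
  by (simp add: matrix_matrix_mult_def mult_delta_left)

lemma diagonal_matrix_mult_vec:
  "((\<chi> y z. if y = z then d y else 0) *v v) $ a = (d a :: complex) * v $ a"
  by (simp add: matrix_vector_mult_def mult_delta_left)

section \<open>Distance in a connected graph\<close>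

lemma gdist_le: "(adj ^^ n) x y \<Longrightarrow> gdist adj x y \<le> n"
  unfolding gdist_def by (rule Least_le)

lemma gdist_walk:
  assumes "simple_connected_graph adj"
  shows "(adj ^^ gdist adj x y) x y"
proof -
  have "adj\<^sup>*\<^sup>* x y"
    using assms by (simp add: simple_connected_graph_def)
  then show ?thesis
    unfolding gdist_def by (metis LeastI rtranclp_imp_relpowp)
qed

lemma gdist_eq_0_iff:
  assumes "simple_connected_graph adj"
  shows "gdist adj x y = 0 \<longleftrightarrow> x = y"
proof
  assume "gdist adj x y = 0"
  then show "x = y"
    using gdist_walk[OF assms, of x y] by simp
next
  assume "x = y"
  then have "(adj ^^ 0) x y"
    by simp
  then show "gdist adj x y = 0"
    using gdist_le by fastforce
qed

lemma relpowp_symmetric: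
  assumes "\<And>x y. r x y \<Longrightarrow> r y x"
  shows "(r ^^ n) x y \<Longrightarrow> (r ^^ n) y x"
proof (induction n arbitrary: y)
  case (Suc n)
  then obtain z where "(r ^^ n) x z" "r z y"
    by auto
  then show ?case
    using Suc.IH assms by (meson relpowp_Suc_I2)
qed auto

lemma gdist_commute:
  assumes "simple_connected_graph adj"
  shows "gdist adj x y = gdist adj y x"
proof -
  have "(adj ^^ n) x y \<longleftrightarrow> (adj ^^ n) y x" for n
    using assms relpowp_symmetric[of adj n] unfolding simple_connected_graph_def by blast
  then show ?thesis
    by (simp add: gdist_def)
qed

lemma gdist_triangle:
  assumes "simple_connected_graph adj"
  shows "gdist adj x z \<le> gdist adj x y + gdist adj y z"
proof -
  have "(adj ^^ (gdist adj x y + gdist adj y z)) x z"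
    using gdist_walk[OF assms, of x y] gdist_walk[OF assms, of y z]
    by (auto simp: relpowp_add)
  then show ?thesis
    by (rule gdist_le)
qed

lemma gdist_le_gdiameter: "gdist adj x y \<le> gdiameter (adj :: 'n::finite \<Rightarrow> 'n \<Rightarrow> bool)"
proof -
  have "{gdist adj x y | x y. True} = (\<lambda>(x, y). gdist adj x y) ` UNIV"
    by auto
  then have "finite {gdist adj x y | x y. True}"
    by simp
  then show ?thesis
    unfolding gdiameter_def by (intro Max_ge) auto
qed

lemma gdist_Suc_neighbour:
  assumes G: "simple_connected_graph adj" and d: "gdist adj x y = Suc j"
  obtains z where "gdist adj x z = 1" "gdist adj z y = j"
proof -
  obtain z where z: "adj x z" "(adj ^^ j) z y"
    using gdist_walk[OF G, of x y] d relpowp_Suc_D2 by metis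
  have "gdist adj x z \<le> 1"
    using z(1) gdist_le[of 1 adj x z] by (simp add: eq_OO)
  moreover have "x \<noteq> z"
    using z(1) G by (auto simp: simple_connected_graph_def)
  ultimately have "gdist adj x z = 1"
    using gdist_eq_0_iff[OF G, of x z] by linarith
  moreover have "gdist adj z y = j"
    using gdist_le[OF z(2)] gdist_triangle[OF G, of x y z] d calculation by linarith
  ultimately show ?thesis
    using that by blast
qed

section \<open>The Bose-Mesner algebra\<close>

lemma dist_matrix_0:
  assumes "simple_connected_graph adj"
  shows "dist_matrix adj 0 = mat 1"
  by (simp add: dist_matrix_def mat_def vec_eq_iff gdist_eq_0_iff[OF assms])

lemma transpose_dist_matrix:
  assumes "simple_connected_graph adj"
  shows "transpose (dist_matrix adj i) = dist_matrix adj i"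
  using gdist_commute[OF assms] by (simp add: dist_matrix_def transpose_def vec_eq_iff)

lemma transpose_bose_mesner:
  assumes "simple_connected_graph adj" and "B \<in> bose_mesner adj"
  shows "transpose B = B"
proof -
  have "cmat.subspace {B :: complex^'n^'n. transpose B = B}"
    by (auto simp: cmat.subspace_def transpose_def vec_eq_iff)
  then have "bose_mesner adj \<subseteq> {B. transpose B = B}"
    unfolding bose_mesner_def
    using transpose_dist_matrix[OF assms(1)] by (intro cmat.span_minimal) auto
  then show ?thesis
    using assms(2) by auto
qed

lemma sum_dist_matrix_nth:
  fixes adj :: "'n::finite \<Rightarrow> 'n \<Rightarrow> bool"
  shows "(\<Sum>i\<le>gdiameter adj. c i *\<^sub>m dist_matrix adj i) $ x $ y = c (gdist adj x y)"
  using gdist_le_gdiameter[of adj x y] by (simp add: dist_matrix_def mult_delta_right)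

text \<open>
  A vertex \<open>z\<close> adjacent to \<open>x\<close> and at distance \<open>j\<close> from \<open>y\<close> forces \<open>x\<close> and \<open>y\<close> to be at distance at
  most \<open>j + 1\<close>, and such a \<open>z\<close> exists on a geodesic when the distance is \<open>j + 1\<close>. The nonzero
  top coefficient expresses \<open>A\<^bsub>j+1\<^esub>\<close> through \<open>A\<^sub>1\<close> and the lower distance-matrices.
\<close>

lemma dist_matrix_recurrence:
  fixes adj :: "'n::finite \<Rightarrow> 'n \<Rightarrow> bool"
  assumes dr: "distance_regular adj" and j: "Suc j \<le> gdiameter adj"
  obtains p c where "p \<noteq> 0"
    and "dist_matrix adj 1 ** dist_matrix adj j =
      p *\<^sub>m dist_matrix adj (Suc j) + (\<Sum>h\<le>j. c h *\<^sub>m dist_matrix adj h)"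
proof -
  have G: "simple_connected_graph adj"
    using dr by (simp add: distance_regular_def)
  define N where "N x y = card {z. gdist adj x z = 1 \<and> gdist adj y z = j}" for x y
  \<comment> \<open>If no pair is at distance \<open>h\<close>, then \<open>A\<^sub>h = 0\<close> and any coefficient will do; the value 1
    keeps the top coefficient nonzero in that case too.\<close>
  define c where "c h = (if \<exists>x y. gdist adj x y = h
      then (SOME p. \<exists>x y. gdist adj x y = h \<and> p = N x y) else 1)" for h
  have N: "N x y = N x' y'" if "gdist adj x y = gdist adj x' y'" for x y x' y'
    unfolding N_def
    by (rule dr[unfolded distance_regular_def, THEN conjunct2, rule_format,
          OF gdist_le_gdiameter[of adj x' y'] _ _ that refl])
      (use j in simp_all)
  have c: "c (gdist adj x y) = N x y" for x y
  proof -
    have "\<exists>x' y'. gdist adj x' y' = gdist adj x y \<and> c (gdist adj x y) = N x' y'"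
      unfolding c_def using someI_ex[of "\<lambda>p. \<exists>x' y'. gdist adj x' y' = gdist adj x y \<and> p = N x' y'"]
      by auto
    then show ?thesis
      using N by metis
  qed
  have prod: "(dist_matrix adj 1 ** dist_matrix adj j) $ x $ y = of_nat (N x y)" for x y
  proof -
    have "(dist_matrix adj 1 ** dist_matrix adj j) $ x $ y =
        (\<Sum>z\<in>UNIV. if gdist adj x z = 1 \<and> gdist adj y z = j then 1 else 0)"
      using gdist_commute[OF G]
      by (auto simp: matrix_matrix_mult_def dist_matrix_def intro!: sum.cong)
    also have "\<dots> = of_nat (N x y)"
      by (simp add: N_def sum.If_cases)
    finally show ?thesis .
  qed
  have nz: "c (Suc j) \<noteq> 0"
  proof (cases "\<exists>x y. gdist adj x y = Suc j")
    case True
    then obtain x y where xy: "gdist adj x y = Suc j"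
      by blast
    then obtain z where "gdist adj x z = 1" "gdist adj z y = j"
      using gdist_Suc_neighbour[OF G] by metis
    then have "z \<in> {z. gdist adj x z = 1 \<and> gdist adj y z = j}"
      using gdist_commute[OF G] by simp
    then have "N x y \<noteq> 0"
      unfolding N_def by (metis card_eq_0_iff empty_iff finite)
    then show ?thesis
      using c[of x y] xy by simp
  qed (simp add: c_def)
  have far: "N x y = 0" if "gdist adj x y > Suc j" for x y
  proof -
    have "{z. gdist adj x z = 1 \<and> gdist adj y z = j} = {}"
    proof (intro equals0I)
      fix z assume "z \<in> {z. gdist adj x z = 1 \<and> gdist adj y z = j}"
      then show False
        using gdist_triangle[OF G, of x y z] gdist_commute[OF G, of z y] that by simp
    qed
    then show ?thesis
      by (simp add: N_def)
  qed
  have "(dist_matrix adj 1 ** dist_matrix adj j) $ x $ y =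
      (\<Sum>h\<le>Suc j. of_nat (c h) *\<^sub>m dist_matrix adj h) $ x $ y" for x y
  proof -
    have "(\<Sum>h\<le>Suc j. of_nat (c h) *\<^sub>m dist_matrix adj h) $ x $ y = of_nat (N x y)"
      using far[of x y] c[of x y]
      by (auto simp: dist_matrix_def mult_delta_right not_le simp del: sum.atMost_Suc)
    then show ?thesis
      using prod by simp
  qed
  then have "dist_matrix adj 1 ** dist_matrix adj j =
      of_nat (c (Suc j)) *\<^sub>m dist_matrix adj (Suc j) + (\<Sum>h\<le>j. of_nat (c h) *\<^sub>m dist_matrix adj h)"
    by (simp add: vec_eq_iff)
  then show ?thesis
    using nz that[of "of_nat (c (Suc j))" "\<lambda>h. of_nat (c h)"] by simp
qed

text \<open>
  This says that \<open>A\<^sub>j\<close> is a polynomial in \<open>A\<^sub>1\<close>, in the form in which it is applied. The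
  scalar depends on the eigenvalue \<open>\<theta>\<close> but not on the eigenvector, which is what allows two
  eigenvectors for the same \<open>\<theta>\<close> to be compared.
\<close>

lemma dist_matrix_eigenvalue:
  fixes adj :: "'n::finite \<Rightarrow> 'n \<Rightarrow> bool"
  assumes dr: "distance_regular adj"
  shows "j \<le> gdiameter adj \<Longrightarrow>
    \<exists>r. \<forall>v. dist_matrix adj 1 *v v = \<theta> *s v \<longrightarrow> dist_matrix adj j *v v = r *s v"
proof (induction j rule: less_induct)
  case (less j)
  show ?case
  proof (cases j)
    case 0
    have "simple_connected_graph adj"
      using dr by (simp add: distance_regular_def)
    then have "dist_matrix adj j *v v = 1 *s v" for v
      using 0 by (simp add: dist_matrix_0)
    then show ?thesis
      by blast
  next
    case (Suc i)
    let ?A = "dist_matrix adj"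
    have i: "Suc i \<le> gdiameter adj"
      using less.prems Suc by simp
    obtain p c where p: "p \<noteq> 0"
      and rec: "?A 1 ** ?A i = p *\<^sub>m ?A (Suc i) + (\<Sum>h\<le>i. c h *\<^sub>m ?A h)"
      by (rule dist_matrix_recurrence[OF dr i])
    have "\<forall>h\<le>i. \<exists>r. \<forall>v. ?A 1 *v v = \<theta> *s v \<longrightarrow> ?A h *v v = r *s v"
      by (intro allI impI less.IH) (use less.prems Suc in simp_all)
    then obtain r where r: "\<And>h v. h \<le> i \<Longrightarrow> ?A 1 *v v = \<theta> *s v \<Longrightarrow> ?A h *v v = r h *s v"
      by metis
    have "?A j *v v = (inverse p * (\<theta> * r i - (\<Sum>h\<le>i. c h * r h))) *s v"
      if v: "?A 1 *v v = \<theta> *s v" for v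
    proof -
      have rv: "?A h *v v = r h *s v" if "h \<le> i" for h
        using r[OF that v] .
      have "?A 1 *v (?A i *v v) = (r i * \<theta>) *s v"
        unfolding rv[OF order_refl] vec.scale v by simp
      then have "(r i * \<theta>) *s v = p *s (?A j *v v) + (\<Sum>h\<le>i. c h *s (?A h *v v))"
        using Suc rec by (simp add: matrix_vector_mul_assoc matrix_vector_mult_add_rdistrib
            cscale_mult_vec sum_matrix_vector_mult)
      also have "(\<Sum>h\<le>i. c h *s (?A h *v v)) = (\<Sum>h\<le>i. c h * r h) *s v"
        unfolding vec.scale_sum_left by (intro sum.cong refl) (simp add: rv)
      finally have "p *s (?A j *v v) = (\<theta> * r i - (\<Sum>h\<le>i. c h * r h)) *s v"
        by (simp add: vec.scale_left_diff_distrib mult.commute)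
      then have "inverse p *s (p *s (?A j *v v)) =
          inverse p *s ((\<theta> * r i - (\<Sum>h\<le>i. c h * r h)) *s v)"
        by simp
      then show ?thesis
        using p by (simp add: vec.scale_left_diff_distrib right_diff_distrib)
    qed
    then show ?thesis
      by blast
  qed
qed

lemma bose_mesner_eigenvalue:
  fixes adj :: "'n::finite \<Rightarrow> 'n \<Rightarrow> bool"
  assumes dr: "distance_regular adj" and "B \<in> bose_mesner adj"
  shows "\<exists>r. \<forall>v. dist_matrix adj 1 *v v = \<theta> *s v \<longrightarrow> B *v v = r *s v"
  using assms(2) unfolding bose_mesner_def
proof (induction rule: cmat.span_induct_alt)
  case base
  show ?case
    by (intro exI[of _ 0]) simp
next
  case (step c A B)
  obtain r where r: "\<And>v. dist_matrix adj 1 *v v = \<theta> *s v \<Longrightarrow> A *v v = r *s v"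
    using step(1) dist_matrix_eigenvalue[OF dr] by blast
  obtain s where s: "\<And>v. dist_matrix adj 1 *v v = \<theta> *s v \<Longrightarrow> B *v v = s *s v"
    using step(2) by blast
  show ?case
    by (intro exI[of _ "c * r + s"])
      (simp add: r s matrix_vector_mult_add_rdistrib cscale_mult_vec vec.scale_left_distrib)
qed

lemma valency_eq_card:
  fixes adj :: "'n::finite \<Rightarrow> 'n \<Rightarrow> bool"
  assumes dr: "distance_regular adj" and i: "i \<le> gdiameter adj"
  shows "valency adj i = card {y. gdist adj x y = i}"
proof -
  have G: "simple_connected_graph adj"
    using dr by (simp add: distance_regular_def)
  have eq: "card {z. gdist adj u z = i \<and> gdist adj v z = i} = card {y. gdist adj x y = i}"
    if "gdist adj u v = 0" for u v
  proof -
    have "gdist adj x x = 0"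
      using gdist_eq_0_iff[OF G] by simp
    then show ?thesis
      using dr[unfolded distance_regular_def, THEN conjunct2, rule_format, OF le0 i i that]
      by simp
  qed
  have x0: "gdist adj x x = 0"
    using gdist_eq_0_iff[OF G] by simp
  show ?thesis
    unfolding valency_def intersection_number_def
  proof (rule the_equality)
    show "\<forall>u v. gdist adj u v = 0 \<longrightarrow>
        card {z. gdist adj u z = i \<and> gdist adj v z = i} = card {y. gdist adj x y = i}"
      using eq by blast
  next
    fix p assume "\<forall>u v. gdist adj u v = 0 \<longrightarrow>
        card {z. gdist adj u z = i \<and> gdist adj v z = i} = p"
    then have "card {z. gdist adj x z = i \<and> gdist adj x z = i} = p"
      using x0 by blast
    then show "p = card {y. gdist adj x y = i}"
      by simp
  qed
qed

section \<open>Primitive idempotents\<close>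

lemma primitive_idempotents_nonzero:
  assumes "primitive_idempotents adj E" and "i \<le> gdiameter adj"
  shows "E i \<noteq> 0"
  using assms cmat.dependent_zero[of "E ` {..gdiameter adj}"]
  unfolding primitive_idempotents_def by force

lemma primitive_idempotents_in_bose_mesner:
  assumes "primitive_idempotents adj E" and "i \<le> gdiameter adj"
  shows "E i \<in> bose_mesner adj"
  using assms cmat.span_base[of "E i" "E ` {..gdiameter adj}"]
  unfolding primitive_idempotents_def by auto

lemma sum_idempotents_mult:
  assumes "primitive_idempotents adj E" and "j \<le> gdiameter adj"
  shows "(\<Sum>i\<le>gdiameter adj. c i *\<^sub>m E i) ** E j = c j *\<^sub>m E j"
proof -
  have "(\<Sum>i\<le>gdiameter adj. c i *\<^sub>m E i) ** E j =
      (\<Sum>i\<le>gdiameter adj. if i = j then c i *\<^sub>m E i else 0)"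
    using assms unfolding sum_matrix_mult primitive_idempotents_def
    by (intro sum.cong) (auto simp: cscale_mult_left)
  also have "\<dots> = c j *\<^sub>m E j"
    using assms(2) by simp
  finally show ?thesis .
qed

lemma sum_idempotents_mult_sum:
  assumes "primitive_idempotents adj E"
  shows "(\<Sum>i\<le>gdiameter adj. c i *\<^sub>m E i) ** (\<Sum>i\<le>gdiameter adj. d i *\<^sub>m E i) =
    (\<Sum>i\<le>gdiameter adj. (c i * d i) *\<^sub>m E i)"
proof -
  have "M ** (\<Sum>i\<in>S. d i *\<^sub>m E i) = (\<Sum>i\<in>S. d i *\<^sub>m (M ** E i))" for M and S :: "nat set"
    by (induction S rule: infinite_finite_induct) (auto simp: matrix_add_ldistrib cscale_mult_right)
  then show ?thesis
    using sum_idempotents_mult[OF assms, of _ c] by (simp add: mult.commute)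
qed

lemma sum_idempotents_mult_ones:
  fixes adj :: "'n::finite \<Rightarrow> 'n \<Rightarrow> bool"
  assumes "primitive_idempotents adj E"
  shows "(\<Sum>i\<le>gdiameter adj. c i *\<^sub>m E i) *v 1 = c 0 *s 1"
proof -
  have E0: "E 0 *v 1 = 1"
    using assms by (simp add: primitive_idempotents_def vec_eq_iff matrix_vector_mult_def)
  have "(\<Sum>i\<le>gdiameter adj. c i *\<^sub>m E i) *v 1 = ((\<Sum>i\<le>gdiameter adj. c i *\<^sub>m E i) ** E 0) *v 1"
    by (simp add: E0 flip: matrix_vector_mul_assoc)
  also have "\<dots> = c 0 *s 1"
    using sum_idempotents_mult[OF assms, of 0 c] E0 by (simp add: cscale_mult_vec)
  finally show ?thesis .
qed

text \<open>
  The idempotent \<open>E\<^sub>0\<close> is a polynomial in \<open>A\<^sub>1\<close>, so it acts on the whole \<open>\<theta>\<^sub>0\<close>-eigenspace by the scalar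
  by which it acts on the all-ones vector, which is 1. It vanishes on the image of \<open>E\<^sub>i\<close> when
  \<open>i > 0\<close>, so that image is not contained in the eigenspace.
\<close>

lemma eigenvalue_0_simple:
  fixes adj :: "'n::finite \<Rightarrow> 'n \<Rightarrow> bool"
  assumes dr: "distance_regular adj" and E: "primitive_idempotents adj E"
    and A: "dist_matrix adj 1 = (\<Sum>i\<le>gdiameter adj. \<theta> i *\<^sub>m E i)"
    and i: "0 < i" "i \<le> gdiameter adj"
  shows "\<theta> i \<noteq> \<theta> 0"
proof
  assume eq: "\<theta> i = \<theta> 0"
  obtain r where r: "\<And>v. dist_matrix adj 1 *v v = \<theta> 0 *s v \<Longrightarrow> E 0 *v v = r *s v"
    using bose_mesner_eigenvalue[OF dr primitive_idempotents_in_bose_mesner[OF E]] by blast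
  have E0: "E 0 *v 1 = 1"
    using E by (simp add: primitive_idempotents_def vec_eq_iff matrix_vector_mult_def)
  have "r = 1"
  proof -
    have "E 0 *v 1 = r *s 1"
      by (rule r) (simp only: A sum_idempotents_mult_ones[OF E])
    then show ?thesis
      unfolding E0 by (simp add: vec_eq_iff)
  qed
  have "E i *v w = 0" for w
  proof -
    have "dist_matrix adj 1 *v (E i *v w) = \<theta> 0 *s (E i *v w)"
      using A sum_idempotents_mult[OF E i(2), of \<theta>] eq
      by (simp add: matrix_vector_mul_assoc cscale_mult_vec)
    then have "E 0 *v (E i *v w) = E i *v w"
      using r \<open>r = 1\<close> by simp
    moreover have "E 0 ** E i = 0"
      using E i unfolding primitive_idempotents_def by auto
    ultimately show ?thesis
      by (simp add: matrix_vector_mul_assoc)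
  qed
  then have "E i = 0"
    by (simp add: matrix_eq)
  then show False
    using primitive_idempotents_nonzero[OF E i(2)] by simp
qed

section \<open>The standard module is a sum of irreducible modules\<close>

text \<open>
  The matrices that map \<open>U\<close> into itself form a subalgebra, so invariance need only be checked
  on generators.
\<close>

lemma T_moduleI:
  fixes adj :: "'n::finite \<Rightarrow> 'n \<Rightarrow> bool"
  assumes U: "vec.subspace U"
    and A: "\<And>i u. i \<le> gdiameter adj \<Longrightarrow> u \<in> U \<Longrightarrow> dist_matrix adj i *v u \<in> U"
    and D: "\<And>i u. i \<le> gdiameter adj \<Longrightarrow> u \<in> U \<Longrightarrow> dual_idempotent adj x i *v u \<in> U"
  shows "T_module adj x U"
proof -
  let ?S = "{B :: complex^'n^'n. \<forall>u\<in>U. B *v u \<in> U}"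
  have sub: "cmat.subspace ?S"
    using U by (auto simp: cmat.subspace_def cscale_mult_vec matrix_vector_mult_add_rdistrib
        vec.subspace_0 vec.subspace_add vec.subspace_scale)
  have "subalgebra ?S"
    using sub by (simp add: subalgebra_def flip: matrix_vector_mul_assoc)
  moreover have "bose_mesner adj \<subseteq> ?S"
    unfolding bose_mesner_def using A sub by (intro cmat.span_minimal) auto
  moreover have "dual_idempotent adj x ` {..gdiameter adj} \<subseteq> ?S"
    using D by auto
  ultimately have "terwilliger_algebra adj x \<subseteq> ?S"
    unfolding terwilliger_algebra_def by (intro hull_minimal) auto
  then show ?thesis
    using U unfolding T_module_def by auto
qed

lemma T_moduleD:
  assumes "T_module adj x U"
  shows "vec.subspace U"
    and "i \<le> gdiameter adj \<Longrightarrow> u \<in> U \<Longrightarrow> dist_matrix adj i *v u \<in> U"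
    and "i \<le> gdiameter adj \<Longrightarrow> u \<in> U \<Longrightarrow> dual_idempotent adj x i *v u \<in> U"
proof -
  show "vec.subspace U"
    using assms by (simp add: T_module_def)
  have T: "bose_mesner adj \<union> dual_idempotent adj x ` {..gdiameter adj} \<subseteq> terwilliger_algebra adj x"
    unfolding terwilliger_algebra_def by (rule hull_subset)
  show "dist_matrix adj i *v u \<in> U" if "i \<le> gdiameter adj" "u \<in> U"
  proof -
    have "dist_matrix adj i \<in> bose_mesner adj"
      unfolding bose_mesner_def using that by (intro cmat.span_base) auto
    then show ?thesis
      using assms T that unfolding T_module_def by blast
  qed
  show "dual_idempotent adj x i *v u \<in> U" if "i \<le> gdiameter adj" "u \<in> U"
    using assms T that unfolding T_module_def by blast
qed

lemma T_module_span_Union: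
  assumes "\<And>U. U \<in> \<U> \<Longrightarrow> T_module adj x U"
  shows "T_module adj x (vec.span (\<Union>\<U>))"
proof -
  have "B *v u \<in> vec.span (\<Union>\<U>)"
    if B: "\<And>U u. U \<in> \<U> \<Longrightarrow> u \<in> U \<Longrightarrow> B *v u \<in> U" and u: "u \<in> vec.span (\<Union>\<U>)" for B u
    using u
  proof (induction rule: vec.span_induct_alt)
    case base
    show ?case
      by (simp add: vec.span_zero)
  next
    case (step c v w)
    have "B *v v \<in> vec.span (\<Union>\<U>)"
      using step(1) B by (intro vec.span_base) blast
    then show ?case
      using step(2)
      by (simp add: matrix_vector_right_distrib vec.scale vec.span_add vec.span_scale)
  qed
  note stable = this
  show ?thesis
    using T_moduleD(2,3)[OF assms] stable by (intro T_moduleI) (auto simp: vec.subspace_span)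
qed

text \<open>
  On complex vectors \<open>inner\<close> is the real part of the Hermitian form. The two forms give the same
  orthogonal complement of a complex subspace, so the real form suffices, and this rule is what
  makes such a complement a complex subspace.
\<close>

lemma inner_vector_scalar_mult:
  "inner (c *s u) v = inner u (cnj c *s v :: complex^'n)"
  by (simp add: inner_vec_def inner_complex_def algebra_simps)

lemma inner_real_symmetric_mult:
  fixes B :: "complex^'n^'n"
  assumes sym: "transpose B = B" and real: "\<And>i j. cnj (B $ i $ j) = B $ i $ j"
  shows "inner (B *v u) v = inner u (B *v v)"
proof -
  have herm: "inner a b = Re (\<Sum>i\<in>UNIV. a $ i * cnj (b $ i))" for a b :: "complex^'n"
    by (simp add: inner_vec_def inner_complex_def)
  have B: "B $ i $ j = B $ j $ i" for i j
    using sym by (metis transpose_def vec_lambda_beta)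
  have "(\<Sum>i\<in>UNIV. (B *v u) $ i * cnj (v $ i)) =
      (\<Sum>i\<in>UNIV. \<Sum>j\<in>UNIV. B $ i $ j * u $ j * cnj (v $ i))"
    by (simp add: matrix_vector_mult_def sum_distrib_right)
  also have "\<dots> = (\<Sum>j\<in>UNIV. \<Sum>i\<in>UNIV. B $ i $ j * u $ j * cnj (v $ i))"
    by (rule sum.swap)
  also have "\<dots> = (\<Sum>j\<in>UNIV. u $ j * cnj ((B *v v) $ j))"
  proof (rule sum.cong[OF refl])
    fix j
    have "cnj ((B *v v) $ j) = (\<Sum>i\<in>UNIV. B $ i $ j * cnj (v $ i))"
      unfolding matrix_vector_mult_def by (simp add: real) (metis B)
    then show "(\<Sum>i\<in>UNIV. B $ i $ j * u $ j * cnj (v $ i)) = u $ j * cnj ((B *v v) $ j)"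
      by (simp add: sum_distrib_left algebra_simps)
  qed
  finally show ?thesis
    by (simp only: herm)
qed

text \<open>The generators of \<open>T(x)\<close> are real symmetric matrices, hence self-adjoint.\<close>

lemma T_module_orthogonal_complement:
  fixes adj :: "'n::finite \<Rightarrow> 'n \<Rightarrow> bool"
  assumes G: "simple_connected_graph adj" and U: "T_module adj x U"
  shows "T_module adj x {v. \<forall>u\<in>U. inner u v = 0}"
proof (rule T_moduleI)
  show "vec.subspace {v. \<forall>u\<in>U. inner u v = 0}"
  proof (rule vec.subspaceI)
    fix c v assume v: "v \<in> {v. \<forall>u\<in>U. inner u v = 0}"
    have "inner u (c *s v) = 0" if "u \<in> U" for u
    proof -
      have "cnj c *s u \<in> U"
        using T_moduleD(1)[OF U] that by (rule vec.subspace_scale)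
      then have "inner (cnj c *s u) v = 0"
        using v by blast
      then show ?thesis
        by (simp add: inner_vector_scalar_mult)
    qed
    then show "c *s v \<in> {v. \<forall>u\<in>U. inner u v = 0}"
      by blast
  qed (auto simp: inner_add_right)
next
  fix i v assume i: "i \<le> gdiameter adj" and v: "v \<in> {v. \<forall>u\<in>U. inner u v = 0}"
  have self_adjoint: "inner (dist_matrix adj i *v u) v = inner u (dist_matrix adj i *v v)" for u
    by (rule inner_real_symmetric_mult[OF transpose_dist_matrix[OF G]]) (simp add: dist_matrix_def)
  then show "dist_matrix adj i *v v \<in> {v. \<forall>u\<in>U. inner u v = 0}"
    using v T_moduleD(2)[OF U i] by (auto simp flip: self_adjoint)
next
  fix i v assume i: "i \<le> gdiameter adj" and v: "v \<in> {v. \<forall>u\<in>U. inner u v = 0}"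
  have self_adjoint: "inner (dual_idempotent adj x i *v u) v = inner u (dual_idempotent adj x i *v v)" for u
    by (rule inner_real_symmetric_mult)
      (auto simp: dual_idempotent_def transpose_def vec_eq_iff)
  then show "dual_idempotent adj x i *v v \<in> {v. \<forall>u\<in>U. inner u v = 0}"
    using v T_moduleD(3)[OF U i] by (auto simp flip: self_adjoint)
qed

text \<open>A nonzero submodule of minimal dimension is irreducible.\<close>

lemma irreducible_T_submodule_exists:
  assumes "T_module adj x U" and "U \<noteq> {0}"
  obtains U' where "irreducible_T_module adj x U'" and "U' \<subseteq> U"
proof -
  define good where "good U' \<longleftrightarrow> T_module adj x U' \<and> U' \<noteq> {0} \<and> U' \<subseteq> U" for U'
  obtain U' where U': "good U'" and least: "\<And>U''. good U'' \<Longrightarrow> vec.dim U' \<le> vec.dim U''"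
    using assms ex_has_least_nat[of good U vec.dim] unfolding good_def by blast
  have "U'' = {0} \<or> U'' = U'" if "T_module adj x U''" "U'' \<subseteq> U'" for U''
  proof (rule disjCI)
    assume ne: "U'' \<noteq> U'"
    show "U'' = {0}"
    proof (rule ccontr)
      assume "U'' \<noteq> {0}"
      then have "vec.dim U' \<le> vec.dim U''"
        using that U' by (intro least) (auto simp: good_def)
      then have "U'' = U'"
        using that U' T_moduleD(1) unfolding good_def by (intro vec.subspace_dim_equal) auto
      then show False
        using ne by simp
    qed
  qed
  then have "irreducible_T_module adj x U'"
    using U' by (auto simp: irreducible_T_module_def good_def)
  then show ?thesis
    using that U' by (auto simp: good_def)
qed

text \<open>
  If the irreducible modules did not span \<open>V\<close>, the orthogonal complement of their span would be
  a nonzero module, and an irreducible module inside it would be orthogonal to itself.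
\<close>

lemma span_irreducible_T_modules:
  fixes adj :: "'n::finite \<Rightarrow> 'n \<Rightarrow> bool"
  assumes G: "simple_connected_graph adj"
  shows "vec.span (\<Union>{U. irreducible_T_module adj x U}) = UNIV"
proof (rule ccontr)
  let ?S = "vec.span (\<Union>{U. irreducible_T_module adj x U})"
  let ?C = "{v. \<forall>u\<in>?S. inner u v = 0}"
  assume ne: "?S \<noteq> UNIV"
  have S: "T_module adj x ?S"
    by (rule T_module_span_Union) (simp add: irreducible_T_module_def)
  have C: "T_module adj x ?C"
    using T_module_orthogonal_complement[OF G S] .
  have "subspace ?S"
  proof (rule subspaceI)
    fix r :: real and v assume "v \<in> ?S"
    moreover have "r *\<^sub>R v = complex_of_real r *s v"
      by (simp add: vec_eq_iff scaleR_conv_of_real[where 'a = complex])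
    ultimately show "r *\<^sub>R v \<in> ?S"
      by (simp add: vec.span_scale)
  qed (auto simp: vec.span_zero vec.span_add)
  then have "span ?S \<noteq> UNIV"
    using ne by (metis span_eq_iff)
  then obtain a where "a \<noteq> 0" "\<forall>u\<in>span ?S. inner a u = 0"
    using span_not_UNIV_orthogonal by blast
  then have "a \<in> ?C"
    by (auto simp: inner_commute intro: span_base)
  then have "?C \<noteq> {0}"
    using \<open>a \<noteq> 0\<close> by blast
  then obtain U where U: "irreducible_T_module adj x U" "U \<subseteq> ?C"
    using irreducible_T_submodule_exists[OF C] by blast
  have "u = 0" if "u \<in> U" for u
  proof -
    have "u \<in> ?S"
      using U(1) that by (intro vec.span_base) blast
    then have "inner u u = 0"
      using U(2) that by blast
    then show ?thesis
      by simp
  qed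
  moreover have "0 \<in> U"
    using U(1) T_moduleD(1)[of adj x U] by (simp add: irreducible_T_module_def vec.subspace_0)
  ultimately have "U = {0}"
    by blast
  then show False
    using U(1) by (simp add: irreducible_T_module_def)
qed

lemma matrix_eq_on_irreducible_T_modules:
  fixes adj :: "'n::finite \<Rightarrow> 'n \<Rightarrow> bool"
  assumes "simple_connected_graph adj"
    and eq: "\<And>U u. irreducible_T_module adj x U \<Longrightarrow> u \<in> U \<Longrightarrow> F *v u = H *v u"
  shows "F = H"
proof -
  have "F *v u = H *v u" if "u \<in> vec.span (\<Union>{U. irreducible_T_module adj x U})" for u
    using that
    by (induction rule: vec.span_induct_alt)
      (auto simp: matrix_vector_right_distrib vec.scale eq)
  then show ?thesis
    using span_irreducible_T_modules[OF assms(1)] by (simp add: matrix_eq)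
qed

section \<open>Boltzmann pairs as matrix identities\<close>

text \<open>
  The Boltzmann condition \<open>W A' W\<^bsup>-1\<^esup> = W'\<^bsup>-1\<^esup> A W'\<close> cleared of inverses, by evaluating it at \<open>W u\<close> and
  applying \<open>W'\<close>. The resulting equation of matrix products no longer depends on \<open>U\<close>, so it can be
  assembled over all irreducible modules.
\<close>

lemma boltzmann_pair_act:
  assumes bp: "boltzmann_pair U (act U A) (act U A') (act U W) (act U W')"
    and A: "act U A \<in> End_on U" and A': "act U A' \<in> End_on U" and u: "u \<in> U"
  shows "A *v (W' *v (W *v u)) = W' *v (W *v (A' *v u))"
proof -
  have bij: "bij_betw (act U W) U U" "bij_betw (act U W') U U"
    and eq: "compose U (act U W) (compose U (act U A') (inverse_on U (act U W))) =
      compose U (inverse_on U (act U W')) (compose U (act U A) (act U W'))"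
    using bp by (auto simp: boltzmann_pair_def)
  have mem: "W *v v \<in> U" "W' *v v \<in> U" "A *v v \<in> U" "A' *v v \<in> U" if "v \<in> U" for v
  proof -
    have "act U W v \<in> U" "act U W' v \<in> U"
      using bij[THEN bij_betwE] that by blast+
    moreover have "act U A v \<in> U" "act U A' v \<in> U"
      using A A' that by (auto simp only: End_on_def mem_Collect_eq intro: PiE_mem)
    ultimately show "W *v v \<in> U" "W' *v v \<in> U" "A *v v \<in> U" "A' *v v \<in> U"
      using that by (simp_all add: act_def)
  qed
  have inv: "inv_into U (act U W) (W *v u) = u"
    using inv_into_f_f[OF bij_betw_imp_inj_on[OF bij(1)] u] u by (simp add: act_def)
  have "W *v (A' *v u) = inv_into U (act U W') (A *v (W' *v (W *v u)))"
    using fun_cong[OF eq, of "W *v u"] u mem inv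
    by (simp add: compose_def inverse_on_def act_def)
  moreover have "act U W' (inv_into U (act U W') (A *v (W' *v (W *v u)))) = A *v (W' *v (W *v u))"
    using bij(2) mem u by (intro f_inv_into_f) (simp add: bij_betw_def)
  ultimately have "act U W' (W *v (A' *v u)) = A *v (W' *v (W *v u))"
    by simp
  then show ?thesis
    using mem(1)[OF mem(4)[OF u]] by (simp add: act_def)
qed

lemma balanced_act:
  assumes "balanced U (act U W) (act U W')"
    and "bij_betw (act U W) U U" and "bij_betw (act U W') U U" and u: "u \<in> U"
  shows "W *v (W' *v (W *v u)) = W' *v (W *v (W' *v u))"
proof -
  have mem: "W *v v \<in> U" "W' *v v \<in> U" if "v \<in> U" for v
  proof -
    have "act U W v \<in> U" "act U W' v \<in> U"
      using assms(2,3)[THEN bij_betwE] that by blast+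
    then show "W *v v \<in> U" "W' *v v \<in> U"
      using that by (simp_all add: act_def)
  qed
  then show ?thesis
    using fun_cong[OF assms(1)[unfolded balanced_def], of u] u
    by (simp add: compose_def act_def)
qed

section \<open>Spin models from the two matrix identities\<close>

text \<open>
  The entries of \<open>S\<close> are \<open>q\<close> times the reciprocals of those of \<open>W\<close>, so an entry of \<open>W S\<close> is a
  type II sum. The \<open>(a,b)\<close>-entry of the braid relation for the vertex \<open>c\<close> is the star-triangle
  relation at \<open>a, b, c\<close>, because multiplication by a diagonal matrix only rescales entries.
\<close>

lemma spin_model_of_braid_relation:
  fixes W S :: "complex^'n^'n::finite"
  defines "q \<equiv> complex_of_real (sqrt (real CARD('n)))"
  assumes sym: "transpose W = W" "transpose S = S"
    and recip: "\<And>x y. W $ x $ y * S $ x $ y = q"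
    and inv: "W ** S = (of_nat CARD('n) * q) *\<^sub>m mat 1"
    and braid: "\<And>x. W ** (\<chi> y z. if y = z then S $ x $ y else 0) ** W =
      (\<chi> y z. if y = z then S $ x $ y else 0) ** W ** (\<chi> y z. if y = z then S $ x $ y else 0)"
  shows "spin_model W"
proof -
  have q: "q \<noteq> 0" "q * q = of_nat CARD('n)"
    by (simp_all add: q_def flip: of_real_mult)
  have W0: "W $ x $ y \<noteq> 0" for x y
    using recip[of x y] q by auto
  have S: "S $ x $ y = q / W $ x $ y" for x y
    using recip[of x y] W0[of x y] by (simp add: field_simps)
  have symW: "W $ x $ y = W $ y $ x" and symS: "S $ x $ y = S $ y $ x" for x y
    using sym by (metis transpose_def vec_lambda_beta)+
  have "(\<Sum>y\<in>UNIV. W $ a $ y / W $ b $ y) = (if a = b then of_nat CARD('n) else 0)" for a b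
  proof -
    have "q * (\<Sum>y\<in>UNIV. W $ a $ y / W $ b $ y) = (W ** S) $ a $ b"
    proof -
      have "S $ y $ b = q / W $ b $ y" for y
        using S[of b y] symS[of y b] by simp
      then show ?thesis
        by (simp add: matrix_matrix_mult_def sum_distrib_left mult.commute)
    qed
    also have "\<dots> = q * (if a = b then of_nat CARD('n) else 0)"
      by (simp add: inv mat_def)
    finally show ?thesis
      using q by simp
  qed
  moreover have "(\<Sum>y\<in>UNIV. W $ a $ y * W $ b $ y / W $ c $ y) =
      q * (W $ a $ b / (W $ a $ c * W $ b $ c))" for a b c
  proof -
    have "q * (\<Sum>y\<in>UNIV. W $ a $ y * W $ b $ y / W $ c $ y) =
        (\<Sum>y\<in>UNIV. W $ a $ y * S $ c $ y * W $ y $ b)"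
      by (simp add: S symW[of _ b] sum_distrib_left algebra_simps)
    also have "\<dots> = (W ** (\<chi> y z. if y = z then S $ c $ y else 0) ** W) $ a $ b"
      unfolding matrix_matrix_mult_def[of "W ** _" W] by (simp add: mult_diagonal_matrix)
    also have "\<dots> = S $ c $ a * W $ a $ b * S $ c $ b"
      by (simp only: braid mult_diagonal_matrix diagonal_matrix_mult)
    also have "\<dots> = q * (q * (W $ a $ b / (W $ a $ c * W $ b $ c)))"
      by (simp add: S symW[of c])
    finally show ?thesis
      unfolding mult_left_cancel[OF q(1)] .
  qed
  ultimately show ?thesis
    using sym W0 by (auto simp: spin_model_def type_II_def q_def)
qed

lemma bose_mesner_subset_nomura_algebra:
  fixes adj :: "'n::finite \<Rightarrow> 'n \<Rightarrow> bool"
  assumes dr: "distance_regular adj"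
    and eig: "\<And>b c. \<exists>r. dist_matrix adj 1 *v nomura_vector W b c = r *s nomura_vector W b c"
  shows "bose_mesner adj \<subseteq> nomura_algebra W"
proof
  fix B assume B: "B \<in> bose_mesner adj"
  have G: "simple_connected_graph adj"
    using dr by (simp add: distance_regular_def)
  have "\<exists>r. B *v nomura_vector W b c = r *s nomura_vector W b c" for b c
    using eig[of b c] bose_mesner_eigenvalue[OF dr B] by metis
  then show "B \<in> nomura_algebra W"
    using transpose_bose_mesner[OF G B] by (simp add: nomura_algebra_def)
qed

text \<open>
  Formal self-duality says that the linear map sending each \<open>E\<^sub>i\<close> to \<open>A\<^sub>i\<close> sends each \<open>A\<^sub>j\<close> to
  \<open>|X| E\<^sub>j\<close>. The lemma applies this map to both sides of an equation in the Bose-Mesner algebra.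
\<close>

lemma self_dual_coefficients:
  fixes adj :: "'n::finite \<Rightarrow> 'n \<Rightarrow> bool"
  assumes E: "primitive_idempotents adj E"
    and P: "first_eigenmatrix adj E P" and Q: "second_eigenmatrix adj E P"
    and eq: "(\<Sum>i\<le>gdiameter adj. s i *\<^sub>m dist_matrix adj i) = (\<Sum>i\<le>gdiameter adj. t i *\<^sub>m E i)"
  shows "of_nat CARD('n) *\<^sub>m (\<Sum>i\<le>gdiameter adj. s i *\<^sub>m E i) =
    (\<Sum>i\<le>gdiameter adj. t i *\<^sub>m dist_matrix adj i)"
proof -
  let ?D = "gdiameter adj"
  have "(\<Sum>j\<le>?D. s j *\<^sub>m dist_matrix adj j) = (\<Sum>j\<le>?D. \<Sum>i\<le>?D. (s j * P i j) *\<^sub>m E i)"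
    using P by (intro sum.cong refl)
      (simp add: first_eigenmatrix_def cmat.scale_sum_right)
  also have "\<dots> = (\<Sum>i\<le>?D. \<Sum>j\<le>?D. (s j * P i j) *\<^sub>m E i)"
    by (rule sum.swap)
  also have "\<dots> = (\<Sum>i\<le>?D. (\<Sum>j\<le>?D. s j * P i j) *\<^sub>m E i)"
    by (simp add: cmat.scale_sum_left)
  finally have exp: "(\<Sum>i\<le>?D. t i *\<^sub>m E i) = (\<Sum>i\<le>?D. (\<Sum>j\<le>?D. s j * P i j) *\<^sub>m E i)"
    using eq by simp
  \<comment> \<open>Comparison of coefficients: multiplication by \<open>E\<^sub>i\<close> isolates the one at \<open>i\<close>.\<close>
  have t: "t i = (\<Sum>j\<le>?D. s j * P i j)" if i: "i \<le> ?D" for i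
  proof -
    have "t i *\<^sub>m E i = (\<Sum>j\<le>?D. s j * P i j) *\<^sub>m E i"
      using arg_cong[OF exp, of "\<lambda>M. M ** E i"] by (simp only: sum_idempotents_mult[OF E i])
    then show ?thesis
      using primitive_idempotents_nonzero[OF E i] by simp
  qed
  have "(of_nat CARD('n) *\<^sub>m (\<Sum>j\<le>?D. s j *\<^sub>m E j)) $ x $ y =
      (\<Sum>i\<le>?D. t i *\<^sub>m dist_matrix adj i) $ x $ y" for x y
  proof -
    have Ej: "of_nat CARD('n) * E j $ x $ y = P (gdist adj x y) j" if "j \<le> ?D" for j
    proof -
      have "E j = (1 / of_nat CARD('n)) *\<^sub>m (\<Sum>i\<le>?D. P i j *\<^sub>m dist_matrix adj i)"
        using Q that by (simp add: second_eigenmatrix_def)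
      then have "E j $ x $ y = 1 / of_nat CARD('n) * P (gdist adj x y) j"
        by (simp only: cscale_nth sum_dist_matrix_nth)
      then show ?thesis
        by simp
    qed
    have "(of_nat CARD('n) *\<^sub>m (\<Sum>j\<le>?D. s j *\<^sub>m E j)) $ x $ y =
        (\<Sum>j\<le>?D. s j * (of_nat CARD('n) * E j $ x $ y))"
      by (simp add: sum_distrib_left algebra_simps)
    also have "\<dots> = t (gdist adj x y)"
      using Ej t[OF gdist_le_gdiameter] by simp
    finally show ?thesis
      by (simp only: sum_dist_matrix_nth)
  qed
  then show ?thesis
    by (simp add: vec_eq_iff)
qed

theorem theorem13p9:
  fixes adj :: "'n::finite \<Rightarrow> 'n \<Rightarrow> bool"
    and E :: "nat \<Rightarrow> complex^'n^'n"
    and f :: complex and \<tau> :: "nat \<Rightarrow> complex"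
    and W :: "complex^'n^'n" and Wstar :: "'n \<Rightarrow> complex^'n^'n"
  assumes "distance_regular adj"
    and "gdiameter adj \<ge> 1"
    and "primitive_idempotents adj E"
    and "formally_self_dual adj E"
    and "f \<noteq> 0"
    and "\<forall>i\<le>gdiameter adj. \<tau> i \<noteq> 0"
    and "\<tau> 0 = 1"
    and "W = f *\<^sub>m (\<Sum>i\<le>gdiameter adj. \<tau> i *\<^sub>m E i)"
    and "\<forall>x. Wstar x = f *\<^sub>m (\<Sum>i\<le>gdiameter adj. \<tau> i *\<^sub>m dual_idempotent adj x i)"
    and "\<forall>x U. irreducible_T_module adj x U \<longrightarrow> thin adj x U"
    and "\<forall>x U. irreducible_T_module adj x U \<longrightarrow> endpoint adj x U = dual_endpoint adj E U"
    and "\<forall>x U. irreducible_T_module adj x U \<longrightarrow>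
      spin_leonard_pair U (act U (dist_matrix adj 1)) (act U (dual_dist_matrix E x 1)) \<and>
      boltzmann_pair U (act U (dist_matrix adj 1)) (act U (dual_dist_matrix E x 1))
        (act U W) (act U (Wstar x)) \<and>
      balanced U (act U W) (act U (Wstar x))"
    and "f powi (-2) = complex_of_real (real CARD('n) powr (-3/2)) *
      (\<Sum>i\<le>gdiameter adj. of_nat (valency adj i) * \<tau> i)"
  shows "affords adj W"
proof -
  let ?n = "of_nat CARD('n) :: complex" and ?D = "gdiameter adj" and ?A = "dist_matrix adj"
  define q where "q = complex_of_real (sqrt (real CARD('n)))"
  have q: "q \<noteq> 0" "q * q = ?n"
    by (simp_all add: q_def flip: of_real_mult)
  note dr = assms(1) and D1 = assms(2) and E = assms(3) and f = assms(5) and \<tau> = assms(6)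
  have G: "simple_connected_graph adj"
    using dr by (simp add: distance_regular_def)
  obtain P Q where P: "first_eigenmatrix adj E P" and Q: "second_eigenmatrix adj E Q"
    and PQ: "\<And>i j. i \<le> ?D \<Longrightarrow> j \<le> ?D \<Longrightarrow> P i j = Q i j"
    using assms(4) unfolding formally_self_dual_def by blast
  have QP: "second_eigenmatrix adj E P"
    using Q PQ by (simp add: second_eigenmatrix_def)
  define \<theta> where "\<theta> i = P i 1" for i
  have A1: "?A 1 = (\<Sum>i\<le>?D. \<theta> i *\<^sub>m E i)"
    using P D1 by (simp add: first_eigenmatrix_def \<theta>_def)
  \<comment> \<open>Self-duality identifies the dual eigenvalues on the diagonal with the eigenvalues of \<open>A\<^sub>1\<close>.\<close>
  have As: "dual_dist_matrix E x 1 = (\<chi> y z. if y = z then \<theta> (gdist adj x y) else 0)" for x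
  proof -
    have "E 1 = (1 / ?n) *\<^sub>m (\<Sum>i\<le>?D. \<theta> i *\<^sub>m ?A i)"
      using QP D1 by (simp add: second_eigenmatrix_def \<theta>_def)
    then have "?n * E 1 $ x $ y = \<theta> (gdist adj x y)" for y
      by (simp only: cscale_nth sum_dist_matrix_nth) simp
    then show ?thesis
      by (simp add: dual_dist_matrix_def vec_eq_iff)
  qed
  have W: "W = (\<Sum>i\<le>?D. (f * \<tau> i) *\<^sub>m E i)"
    using assms(8) by (simp add: cmat.scale_sum_right)
  define S where "S = (\<Sum>i\<le>?D. (f * \<tau> i) *\<^sub>m ?A i)"
  have S: "S $ x $ y = f * \<tau> (gdist adj x y)" for x y
    by (simp only: S_def sum_dist_matrix_nth)
  have Ws: "Wstar x = (\<chi> y z. if y = z then S $ x $ y else 0)" for x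
  proof -
    have "Wstar x $ y $ z = (if y = z then S $ x $ y else 0)" for y z
      using assms(9) gdist_le_gdiameter[of adj x z]
      by (cases "y = z") (simp_all add: dual_idempotent_def mult_delta_right S)
    then show ?thesis
      by (simp add: vec_eq_iff)
  qed
  have WM: "W \<in> bose_mesner adj"
    unfolding W bose_mesner_def
    using primitive_idempotents_in_bose_mesner[OF E, unfolded bose_mesner_def]
    by (intro cmat.span_sum cmat.span_scale) auto
  have symW: "transpose W = W" and symS: "transpose S = S" and symA: "transpose (?A 1) = ?A 1"
    using transpose_bose_mesner[OF G WM] transpose_dist_matrix[OF G] gdist_commute[OF G]
    by (simp_all add: transpose_def vec_eq_iff S)
  have symD: "transpose (\<chi> y z. if y = z then d y else 0) = (\<chi> y z. if y = z then d y else 0)"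
    for d :: "'n \<Rightarrow> complex"
    by (auto simp: transpose_def vec_eq_iff)

  have braid: "W ** Wstar x ** W = Wstar x ** W ** Wstar x" for x
  proof (rule matrix_eq_on_irreducible_T_modules[OF G])
    fix U u assume U: "irreducible_T_module adj x U" "u \<in> U"
    then show "W ** Wstar x ** W *v u = Wstar x ** W ** Wstar x *v u"
      using assms(12) balanced_act[of U W "Wstar x" u]
      by (simp add: boltzmann_pair_def flip: matrix_vector_mul_assoc)
  qed
  have boltz: "?A 1 ** Wstar x ** W = Wstar x ** W ** dual_dist_matrix E x 1" for x
  proof (rule matrix_eq_on_irreducible_T_modules[OF G])
    fix U u assume U: "irreducible_T_module adj x U" "u \<in> U"
    then show "?A 1 ** Wstar x ** W *v u = Wstar x ** W ** dual_dist_matrix E x 1 *v u"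
      using assms(12) boltzmann_pair_act[of U "?A 1" "dual_dist_matrix E x 1" W "Wstar x" u]
      by (simp add: spin_leonard_pair_def leonard_pair_def flip: matrix_vector_mul_assoc)
  qed
  \<comment> \<open>Transposition supplies the companion identity, in which \<open>A\<^sub>1\<close> acts first.\<close>
  have boltz': "W ** Wstar x ** ?A 1 = dual_dist_matrix E x 1 ** W ** Wstar x" for x
  proof -
    have "transpose (dual_dist_matrix E x 1) = dual_dist_matrix E x 1"
      unfolding As by (rule symD)
    then show ?thesis
      using arg_cong[OF boltz[of x], of transpose] symW symA symD
      by (simp add: matrix_transpose_mul Ws matrix_mul_assoc)
  qed

  have WS: "W ** S = (?n * q) *\<^sub>m mat 1"
  proof -
    have entry: "(W ** S) $ z $ x = ((W ** Wstar x) *v 1) $ z" for z x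
      using symS by (simp add: Ws matrix_vector_mult_def mult_diagonal_matrix)
        (simp add: matrix_matrix_mult_def S gdist_commute[OF G, of x])
    \<comment> \<open>Column \<open>x\<close> is an eigenvector of a diagonal matrix, for an eigenvalue that occurs only in
      position \<open>x\<close>.\<close>
    have off: "(W ** S) $ z $ x = 0" if "z \<noteq> x" for z x
    proof -
      let ?u = "(W ** Wstar x) *v 1"
      have "dual_dist_matrix E x 1 *v ?u = (W ** Wstar x) *v (?A 1 *v 1)"
        using boltz'[of x] by (simp add: matrix_vector_mul_assoc matrix_mul_assoc)
      also have "\<dots> = \<theta> 0 *s ?u"
        by (simp only: A1 sum_idempotents_mult_ones[OF E] vec.scale)
      finally have "(dual_dist_matrix E x 1 *v ?u) $ z = (\<theta> 0 *s ?u) $ z"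
        by simp
      then have "\<theta> (gdist adj x z) * ?u $ z = \<theta> 0 * ?u $ z"
        by (simp only: As diagonal_matrix_mult_vec vector_smult_component)
      moreover have "\<theta> (gdist adj x z) \<noteq> \<theta> 0"
        using gdist_eq_0_iff[OF G, of x z] that
        by (intro eigenvalue_0_simple[OF dr E A1] gdist_le_gdiameter) auto
      ultimately show ?thesis
        by (simp add: entry)
    qed
    \<comment> \<open>The other entries of column \<open>x\<close> vanish, so the diagonal entry is the column sum. The
      columns of \<open>W\<close> sum to \<open>f\<close>, and what remains is the sum in the normalisation of \<open>f\<close>.\<close>
    have diag: "(W ** S) $ x $ x = ?n * q" for x
    proof -
      have row: "(\<Sum>z\<in>UNIV. W $ z $ y) = f" for y
      proof -
        have "W *v 1 = f *s 1"
          using sum_idempotents_mult_ones[OF E, of "\<lambda>i. f * \<tau> i"] assms(7) W by simp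
        then have "(\<Sum>z\<in>UNIV. W $ y $ z) = f"
          by (simp add: matrix_vector_mult_def vec_eq_iff)
        moreover have "W $ y $ z = W $ z $ y" for z
          using symW by (metis transpose_def vec_lambda_beta)
        ultimately show ?thesis
          by simp
      qed
      have "(W ** S) $ x $ x = (\<Sum>z\<in>UNIV. (W ** S) $ z $ x)"
        using off by (subst sum.remove[of _ x]) auto
      also have "\<dots> = (\<Sum>z\<in>UNIV. \<Sum>y\<in>UNIV. W $ z $ y * S $ y $ x)"
        by (simp add: matrix_matrix_mult_def)
      also have "\<dots> = (\<Sum>y\<in>UNIV. \<Sum>z\<in>UNIV. W $ z $ y * S $ y $ x)"
        by (rule sum.swap)
      also have "\<dots> = (\<Sum>y\<in>UNIV. f * S $ y $ x)"
        by (simp add: row flip: sum_distrib_right)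
      also have "\<dots> = f\<^sup>2 * (\<Sum>y\<in>UNIV. \<tau> (gdist adj x y))"
        by (simp add: S gdist_commute[OF G, of _ x] sum_distrib_left power2_eq_square mult.assoc)
      also have "(\<Sum>y\<in>UNIV. \<tau> (gdist adj x y)) =
          (\<Sum>i\<le>?D. \<Sum>y | gdist adj x y = i. \<tau> (gdist adj x y))"
      proof -
        have "range (gdist adj x) \<subseteq> {..?D}"
          using gdist_le_gdiameter[of adj x] by auto
        then show ?thesis
          using sum.group[of UNIV "{..?D}" "gdist adj x" "\<lambda>y. \<tau> (gdist adj x y)"] by simp
      qed
      also have "\<dots> = (\<Sum>i\<le>?D. of_nat (valency adj i) * \<tau> i)"
        by (intro sum.cong refl) (simp add: valency_eq_card[OF dr, of _ x])
      finally have c: "(W ** S) $ x $ x = f\<^sup>2 * (\<Sum>i\<le>?D. of_nat (valency adj i) * \<tau> i)" .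
      have half: "real CARD('n) powr (3/2) = real CARD('n) * sqrt (real CARD('n))"
        using powr_add[of "real CARD('n)" 1 "1/2"] by (simp add: powr_half_sqrt)
      have "real CARD('n) powr (-3/2) * real CARD('n) powr (3/2) = 1"
        by (simp flip: powr_add)
      then have pw: "complex_of_real (real CARD('n) powr (-3/2)) * (?n * q) = 1"
        unfolding q_def half by (metis of_real_1 of_real_mult of_real_of_nat_eq)
      have "f powi (-2) = inverse (f\<^sup>2)"
        by (simp add: power_int_minus)
      then have "f\<^sup>2 * (complex_of_real (real CARD('n) powr (-3/2)) *
          (\<Sum>i\<le>?D. of_nat (valency adj i) * \<tau> i)) = 1"
        unfolding assms(13)[symmetric] using f by simp
      then show ?thesis
        unfolding c using pw by algebra
    qed
    show ?thesis
      using off diag by (simp add: vec_eq_iff mat_def)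
  qed

  have Sexp: "S = (\<Sum>i\<le>?D. (?n * q / (f * \<tau> i)) *\<^sub>m E i)"
  proof -
    define W' where "W' = (\<Sum>i\<le>?D. (1 / (f * \<tau> i)) *\<^sub>m E i)"
    have "W' ** W = (\<Sum>i\<le>?D. E i)"
      unfolding W W'_def sum_idempotents_mult_sum[OF E] using f \<tau> by (intro sum.cong) auto
    then have "W' ** W = mat 1"
      using E by (simp add: primitive_idempotents_def)
    then have "S = W' ** (W ** S)"
      by (simp add: matrix_mul_assoc)
    also have "\<dots> = (?n * q) *\<^sub>m W'"
      by (simp add: WS cscale_mult_right)
    finally show ?thesis
      by (simp add: W'_def cmat.scale_sum_right)
  qed
  have recip: "W $ x $ y * S $ x $ y = q" for x y
  proof -
    have "?n *\<^sub>m W = (\<Sum>i\<le>?D. (?n * q / (f * \<tau> i)) *\<^sub>m ?A i)"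
      unfolding W using self_dual_coefficients[OF E P QP Sexp[unfolded S_def]] .
    then have "(?n *\<^sub>m W) $ x $ y = ?n * (q / (f * \<tau> (gdist adj x y)))"
      by (simp only: sum_dist_matrix_nth times_divide_eq_right)
    then have "W $ x $ y = q / (f * \<tau> (gdist adj x y))"
      unfolding cscale_nth by (rule mult_left_cancel[THEN iffD1, rotated]) simp
    then show ?thesis
      using f \<tau> gdist_le_gdiameter[of adj x y] by (simp add: S)
  qed

  have "spin_model W"
    using spin_model_of_braid_relation[OF symW symS] recip WS braid
    by (simp add: Ws q_def)
  moreover have "bose_mesner adj \<subseteq> nomura_algebra W"
  proof (rule bose_mesner_subset_nomura_algebra[OF dr])
    fix b c
    \<comment> \<open>The identity \<open>boltz\<close> maps columns of \<open>W\<^sup>*(c) W\<close> to multiples of themselves, since the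
      factor on its far right is diagonal.\<close>
    have "nomura_vector W b c $ y = 1 / q * (Wstar c ** W) $ y $ b" for y
    proof -
      have "W $ y $ b = W $ b $ y"
        using symW by (metis transpose_def vec_lambda_beta)
      moreover have "W $ c $ y \<noteq> 0" "S $ c $ y = q / W $ c $ y"
        using recip[of c y] q by (auto simp: field_simps)
      ultimately show ?thesis
        using q by (simp add: nomura_vector_def Ws diagonal_matrix_mult)
    qed
    then have u: "nomura_vector W b c = (1 / q) *s column b (Wstar c ** W)"
      by (simp add: vec_eq_iff column_def)
    have "B *v column b C = column b (B ** C)" for B C :: "complex^'n^'n"
      by (simp add: vec_eq_iff column_def matrix_vector_mult_def matrix_matrix_mult_def)
    then have "?A 1 *v column b (Wstar c ** W) = column b (?A 1 ** Wstar c ** W)"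
      by (simp only: matrix_mul_assoc)
    also have "\<dots> = \<theta> (gdist adj c b) *s column b (Wstar c ** W)"
      unfolding boltz As by (simp add: vec_eq_iff column_def mult_diagonal_matrix)
    finally show "\<exists>r. ?A 1 *v nomura_vector W b c = r *s nomura_vector W b c"
      unfolding u by (metis vec.scale vec.scale_left_commute)
  qed
  ultimately show ?thesis
    using WM by (simp add: affords_def)
qed

end
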